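(* There is an absolute constant $c>0$ such that the following holds. For all positive integers $d$ and all real $\epsilon$ with $1/d \le \epsilon \le 1/8$, every Itemset-Frequency-Indicator sketching scheme for dimension $d$, itemset size $k=2$ and parameter $\epsilon$ has sketch length $m \ge c\,\frac{1}{\epsilon}\, d \log(\epsilon d)$.
   Context: A database is $\mathcal{D} = (\mathcal{D}_1,\dots,\mathcal{D}_n) \in (\{0,1\}^d)^n$ (a list of $n$ rows, $n\ge 1$ arbitrary). For an itemset $T \subseteq [d]=\{1,\dots,d\}$, its frequency is $f_T(\mathcal{D}) = \frac{1}{n}\,\bigl|\{ i \in [n] : (\mathcal{D}_i)_j = 1 \text{ for all } j \in T\}\bigr|$. An Itemset-Frequency-Indicator sketching scheme with dimension $d$, itemset size $k$, parameter $\epsilon$ and sketch length $m$ is a pair of algorithms: a randomized encoder which, given $k,\epsilon$ and any database $\mathcal{D} \in (\{0,1\}^d)^n$ (any $n$), outputs a sketch $S \in \{0,1\}^m$; and a decoder which, given $S$, $\epsilon$ and a set $T\subseteq[d]$ with $|T|=k$, outputs YES or NO. The requirement is: for every database $\mathcal{D}$, with probability at least $3/4$ over the encoder's randomness the encoder "succeeds", meaning that for the resulting sketch $S$ and for \emph{every} query $T$ with $|T|=k$ simultaneously, the decoder outputs YES if $f_T(\mathcal{D}) \ge \epsilon$ and outputs NO if $f_T(\mathcal{D}) \le \epsilon/2$ (either answer is allowed when $\epsilon/2 < f_T(\mathcal{D}) < \epsilon$). $\log$ denotes the logarithm (any fixed base). *)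

theory Defs
  imports "HOL-Probability.Probability"
begin

text \<open>
  A row in \<open>{0,1}\<^sup>d\<close> is a Boolean list of length \<open>d\<close>, with attributes numbered
  \<open>0, \<dots>, d - 1\<close> instead of \<open>1, \<dots>, d\<close>. The number \<open>n\<close> of rows is the length of the
  database.
\<close>

type_synonym database = "bool list list"
type_synonym sketch = "bool list"

datatype answer = YES | NO

definition databases :: "nat \<Rightarrow> database set" where
  "databases d = {D. D \<noteq> [] \<and> (\<forall>row \<in> set D. length row = d)}"

definition itemsets :: "nat \<Rightarrow> nat \<Rightarrow> nat set set" where
  "itemsets d k = {T. T \<subseteq> {..<d} \<and> card T = k}"

definition frequency :: "nat set \<Rightarrow> database \<Rightarrow> real" where
  "frequency T D = real (card {i. i < length D \<and> (\<forall>j \<in> T. D ! i ! j)}) / real (length D)"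

definition encoding_succeeds ::
  "nat \<Rightarrow> nat \<Rightarrow> real \<Rightarrow> (sketch \<Rightarrow> nat set \<Rightarrow> answer) \<Rightarrow> database \<Rightarrow> sketch \<Rightarrow> bool" where
  "encoding_succeeds d k \<epsilon> dec D S \<longleftrightarrow>
     (\<forall>T \<in> itemsets d k.
        (frequency T D \<ge> \<epsilon> \<longrightarrow> dec S T = YES) \<and>
        (frequency T D \<le> \<epsilon> / 2 \<longrightarrow> dec S T = NO))"

text \<open>
  The randomized encoder maps a database to the distribution of its sketch. Sketches range
  over a finite set, so probability mass functions cover every source of randomness. The
  encoder and decoder are arbitrary functions, with no computability requirement. They may
  depend on \<open>d\<close>, \<open>k\<close>, \<open>\<epsilon>\<close> and \<open>m\<close>, which are fixed for the scheme; the encoder must handle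
  databases with any number of rows at the same sketch length \<open>m\<close>.
\<close>

definition itemset_frequency_indicator_scheme ::
  "nat \<Rightarrow> nat \<Rightarrow> real \<Rightarrow> nat \<Rightarrow> (database \<Rightarrow> sketch pmf) \<Rightarrow> (sketch \<Rightarrow> nat set \<Rightarrow> answer) \<Rightarrow> bool" where
  "itemset_frequency_indicator_scheme d k \<epsilon> m enc dec \<longleftrightarrow>
     (\<forall>D \<in> databases d.
        (\<forall>S \<in> set_pmf (enc D). length S = m) \<and>
        measure_pmf.prob (enc D) {S. encoding_succeeds d k \<epsilon> dec D S} \<ge> 3 / 4)"

end

theory Submission
  imports Defs
begin

text \<open>
  Rows are pairs \<open>(p, x)\<close> of a block \<open>p < N\<close> and a word \<open>x \<in> {0,1,2,3}\<^sup>M\<close>, where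
  \<open>N\<close> is about \<open>1 / (4\<epsilon>)\<close> and \<open>M\<close> about \<open>d / (2N)\<close>. The codewords \<open>{x. x i = 0}\<close>, for
  \<open>i < M\<close>, have density \<open>1/4\<close> and pairwise intersections of density \<open>1/16\<close>. The first
  \<open>N M\<close> columns hold one codeword in one block and vanish elsewhere. Each of the other, at
  least \<open>d/2\<close>, columns holds a codeword in every block, and the choice of these codewords is free.
  The itemset of column \<open>(p, i)\<close> and a free column \<open>b\<close> has frequency \<open>1 / (4N) \<ge> \<epsilon>\<close> if \<open>b\<close>
  uses codeword \<open>i\<close> in block \<open>p\<close>, and \<open>1 / (16N) \<le> \<epsilon>/2\<close> otherwise. Hence the sketch determines all
  choices, of which there are at least \<open>M\<close> to the power \<open>N d / 2\<close>.
\<close>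

text \<open>Success has positive probability, so every \<open>Db g\<close> has some succeeding
  sketch. If \<open>g\<close> and \<open>h\<close> shared one, the decoder would have to answer both
  YES and NO on the \<open>T\<close> that separates them.\<close>

lemma scheme_card_le:
  assumes scheme: "itemset_frequency_indicator_scheme d k \<epsilon> m enc dec"
    and db: "\<And>g. g \<in> G \<Longrightarrow> Db g \<in> databases d"
    and sep: "\<And>g h. g \<in> G \<Longrightarrow> h \<in> G \<Longrightarrow> g \<noteq> h \<Longrightarrow>
      \<exists>T \<in> itemsets d k. frequency T (Db g) \<ge> \<epsilon> \<and> frequency T (Db h) \<le> \<epsilon> / 2"
  shows "card G \<le> 2 ^ m"
proof -
  have "\<exists>S. length S = m \<and> encoding_succeeds d k \<epsilon> dec (Db g) S" if "g \<in> G" for g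
  proof -
    have "measure_pmf.prob (enc (Db g)) {S. encoding_succeeds d k \<epsilon> dec (Db g) S} \<noteq> 0"
      and len: "\<forall>S \<in> set_pmf (enc (Db g)). length S = m"
      using scheme db[OF that] unfolding itemset_frequency_indicator_scheme_def by fastforce+
    then show ?thesis
      unfolding measure_pmf_zero_iff by blast
  qed
  then obtain s where s: "\<And>g. g \<in> G \<Longrightarrow> length (s g) = m"
    "\<And>g. g \<in> G \<Longrightarrow> encoding_succeeds d k \<epsilon> dec (Db g) (s g)"
    by metis
  have "inj_on s G"
  proof (rule inj_onI, rule ccontr)
    fix g h assume gh: "g \<in> G" "h \<in> G" "s g = s h" "g \<noteq> h"
    then obtain T where T: "T \<in> itemsets d k" "frequency T (Db g) \<ge> \<epsilon>"
      "frequency T (Db h) \<le> \<epsilon> / 2"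
      using sep by blast
    have "dec (s g) T = YES" "dec (s h) T = NO"
      using T s(2)[OF gh(1)] s(2)[OF gh(2)] unfolding encoding_succeeds_def by blast+
    with gh(3) show False by simp
  qed
  moreover have "s ` G \<subseteq> {xs. set xs \<subseteq> (UNIV :: bool set) \<and> length xs = m}"
    using s(1) by auto
  ultimately have "card G \<le> card {xs. set xs \<subseteq> (UNIV :: bool set) \<and> length xs = m}"
    by (rule card_inj_on_le) (rule finite_lists_length_eq, simp)
  also have "\<dots> = 2 ^ m"
    by (subst card_lists_length_eq) (simp_all add: card_UNIV_bool)
  finally show ?thesis .
qed

text \<open>Turns frequencies into densities in an arbitrary index set. A distinct enumeration of
  \<open>R\<close> counts every index once, even if \<open>B\<close> gives several indices the same
  row.\<close>

lemma ex_database_of_rows: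
  fixes B :: "'r \<Rightarrow> nat \<Rightarrow> bool"
  assumes "finite R" "R \<noteq> {}"
  shows "\<exists>D \<in> databases d. \<forall>T. T \<subseteq> {..<d} \<longrightarrow>
    frequency T D = real (card {r \<in> R. \<forall>j \<in> T. B r j}) / real (card R)"
proof -
  obtain rs where rs: "set rs = R" "distinct rs"
    using finite_distinct_list assms(1) by blast
  define D where "D = map (\<lambda>r. map (B r) [0..<d]) rs"
  have "D \<in> databases d"
    using assms(2) rs by (auto simp: databases_def D_def)
  moreover have "frequency T D = real (card {r \<in> R. \<forall>j \<in> T. B r j}) / real (card R)"
    if T: "T \<subseteq> {..<d}" for T
  proof -
    have "bij_betw ((!) rs) {i. i < length rs \<and> (\<forall>j \<in> T. B (rs ! i) j)} {r \<in> R. \<forall>j \<in> T. B r j}"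
      using rs by (auto simp: bij_betw_def inj_on_def nth_eq_iff_index_eq in_set_conv_nth)
    moreover have "{i. i < length D \<and> (\<forall>j \<in> T. D ! i ! j)}
        = {i. i < length rs \<and> (\<forall>j \<in> T. B (rs ! i) j)}"
      using T by (auto simp: D_def subset_iff)
    ultimately show ?thesis
      unfolding frequency_def using rs
      by (auto simp: D_def distinct_card bij_betw_same_card)
  qed
  ultimately show ?thesis by blast
qed

text \<open>The set is a box in which each coordinate in \<open>J\<close> contributes a factor 1
  instead of \<open>q\<close>.\<close>

lemma card_PiE_vanishing:
  fixes q :: nat
  assumes "finite I" "J \<subseteq> I" "q > 0"
  shows "card {x \<in> I \<rightarrow>\<^sub>E {..<q}. \<forall>j \<in> J. x j = 0} = q ^ (card I - card J)"
proof -
  have "{x \<in> I \<rightarrow>\<^sub>E {..<q}. \<forall>j \<in> J. x j = 0} = (\<Pi>\<^sub>E i\<in>I. if i \<in> J then {0} else {..<q})"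
    (is "?A = ?B")
  proof (rule set_eqI)
    fix x
    have "(\<forall>i \<in> I. x i < q) \<and> (\<forall>j \<in> J. x j = 0)
        \<longleftrightarrow> (\<forall>i \<in> I. x i \<in> (if i \<in> J then {0} else {..<q}))"
      using assms(2,3) by (auto split: if_splits)
    then show "x \<in> ?A \<longleftrightarrow> x \<in> ?B"
      unfolding mem_Collect_eq PiE_iff lessThan_iff by blast
  qed
  also have "card \<dots> = (\<Prod>i\<in>I. if i \<in> J then 1 else q)"
    using assms(1) by (simp add: card_PiE if_distrib cong: if_cong)
  also have "\<dots> = q ^ card (I - J)"
    using assms by (simp add: prod.If_cases Diff_eq)
  finally show ?thesis
    using assms by (simp add: card_Diff_subset finite_subset)
qed

lemma codeword_scheme_bound:
  assumes scheme: "itemset_frequency_indicator_scheme d 2 \<epsilon> m enc dec"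
    and N: "N > 0" and M: "M > 0" and NM: "N * M \<le> d"
    and hi: "4 * real N * \<epsilon> \<le> 1" and lo: "1 \<le> 8 * real N * \<epsilon>"
  shows "M ^ (N * (d - N * M)) \<le> 2 ^ m"
proof -
  define X where "X = {..<M} \<rightarrow>\<^sub>E {..<4::nat}"
  \<comment> \<open>Below \<open>N * M\<close>, column \<open>j\<close> belongs to block
    \<open>j div M\<close> and codeword \<open>j mod M\<close>; for a free column \<open>j\<close>,
    \<open>g (j, p)\<close> names its codeword in block \<open>p\<close>.\<close>
  define B where "B g = (\<lambda>(p, x) j. if j < N * M then j div M = p \<and> x (j mod M) = (0::nat)
      else x (g (j, p)) = 0)" for g :: "nat \<times> nat \<Rightarrow> nat"
  define R where "R = {..<N} \<times> X"
  define G where "G = ({N * M..<d} \<times> {..<N}) \<rightarrow>\<^sub>E {..<M}"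
  have X: "finite X" "card X = 4 ^ M"
    by (auto simp: X_def finite_PiE card_PiE)
  then have R: "finite R" "card R = N * 4 ^ M"
    by (simp_all add: R_def)
  with N have "R \<noteq> {}" by auto
  then have "\<forall>g. \<exists>D. D \<in> databases d \<and> (\<forall>T. T \<subseteq> {..<d} \<longrightarrow>
      frequency T D = real (card {r \<in> R. \<forall>j \<in> T. B g r j}) / real (card R))"
    using ex_database_of_rows[OF R(1)] by blast
  from choice[OF this] obtain Db where Db: "\<And>g. Db g \<in> databases d"
    "\<And>g T. T \<subseteq> {..<d} \<Longrightarrow>
      frequency T (Db g) = real (card {r \<in> R. \<forall>j \<in> T. B g r j}) / real (card R)"
    by auto
  \<comment> \<open>The cardinality is 1 if the codewords agree and 2 otherwise, so one formula
    covers both cases.\<close>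
  have freq: "frequency {p * M + i, b} (Db g) = (1 / 4) ^ card {i, g (b, p)} / real N"
    if g: "g \<in> G" and p: "p < N" and i: "i < M" and b: "N * M \<le> b" "b < d" for g p i b
  proof -
    have "p * M + i < Suc p * M" using i by simp
    also have "\<dots> \<le> N * M" using p by (intro mult_right_mono) auto
    finally have lt: "p * M + i < N * M" .
    have gM: "g (b, p) < M" using g p b by (auto simp: G_def PiE_iff)
    \<comment> \<open>Keeps the natural subtraction in the exponent
      \<open>M - card {i, g (b, p)}\<close> from truncating.\<close>
    have c: "card {i, g (b, p)} \<le> M"
      using card_mono[of "{..<M}" "{i, g (b, p)}"] i gM by auto
    have "{r \<in> R. \<forall>j \<in> {p * M + i, b}. B g r j}
        = {p} \<times> {x \<in> X. \<forall>j \<in> {i, g (b, p)}. x j = 0}"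
      using lt i b p by (auto simp: R_def B_def)
    then have "card {r \<in> R. \<forall>j \<in> {p * M + i, b}. B g r j} = 4 ^ (M - card {i, g (b, p)})"
      using card_PiE_vanishing[of "{..<M}" "{i, g (b, p)}" 4] i gM
      by (simp add: X_def card_cartesian_product)
    moreover have "{p * M + i, b} \<subseteq> {..<d}" using lt b NM by auto
    ultimately have "frequency {p * M + i, b} (Db g)
        = 4 ^ (M - card {i, g (b, p)}) / (real N * 4 ^ M)"
      using Db(2) R(2) by simp
    then show ?thesis
      using c by (simp add: power_diff field_simps)
  qed
  have "card G \<le> 2 ^ m"
  proof (rule scheme_card_le[OF scheme Db(1)])
    fix g h assume g: "g \<in> G" and h: "h \<in> G" and "g \<noteq> h"
    have "\<exists>k \<in> {N * M..<d} \<times> {..<N}. g k \<noteq> h k"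
    proof (rule ccontr)
      assume "\<not> ?thesis"
      then have "g = h"
        using g h unfolding G_def by (intro PiE_ext[of g _ _ h]) auto
      with \<open>g \<noteq> h\<close> show False ..
    qed
    then obtain b p where bp: "N * M \<le> b" "b < d" "p < N" and ne: "g (b, p) \<noteq> h (b, p)"
      by auto
    \<comment> \<open>Querying \<open>b\<close> with the codeword that \<open>g\<close> uses there
      gives a match for \<open>g\<close> and a mismatch for \<open>h\<close>.\<close>
    let ?i = "g (b, p)"
    let ?T = "{p * M + ?i, b}"
    have i: "?i < M" using g bp by (auto simp: G_def PiE_iff)
    have "p * M + ?i < Suc p * M" using i by simp
    also have "\<dots> \<le> N * M" using bp by (intro mult_right_mono) auto
    finally have "?T \<in> itemsets d 2"
      using bp by (auto simp: itemsets_def)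
    moreover have "\<epsilon> \<le> 1 / 4 / real N"
      using hi N by (simp add: field_simps)
    then have "frequency ?T (Db g) \<ge> \<epsilon>"
      using freq[OF g bp(3) i bp(1,2)] by simp
    moreover have "1 / 16 / real N \<le> \<epsilon> / 2"
      using lo N by (simp add: field_simps)
    then have "frequency ?T (Db h) \<le> \<epsilon> / 2"
      using freq[OF h bp(3) i bp(1,2)] ne by (simp add: power2_eq_square)
    ultimately show "\<exists>T \<in> itemsets d 2. frequency T (Db g) \<ge> \<epsilon> \<and> frequency T (Db h) \<le> \<epsilon> / 2"
      by blast
  qed
  then show ?thesis
    by (simp add: G_def card_PiE card_cartesian_product mult.commute)
qed

lemma half_le_floor:
  fixes x :: real
  assumes "x \<ge> 1"
  shows "x / 2 \<le> real (nat \<lfloor>x\<rfloor>)"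
proof -
  have "\<lfloor>x\<rfloor> \<ge> 1" using assms by simp
  then show ?thesis by linarith
qed

theorem theorem1:
  "\<exists>c::real. c > 0 \<and>
     (\<forall>(d::nat) (\<epsilon>::real) (m::nat) (enc :: database \<Rightarrow> sketch pmf)
        (dec :: sketch \<Rightarrow> nat set \<Rightarrow> answer).
        d \<ge> 1 \<longrightarrow> 1 / real d \<le> \<epsilon> \<longrightarrow> \<epsilon> \<le> 1 / 8 \<longrightarrow>
        itemset_frequency_indicator_scheme d 2 \<epsilon> m enc dec \<longrightarrow>
        real m \<ge> c * (1 / \<epsilon>) * real d * log 2 (\<epsilon> * real d))"
\<comment> \<open>The constant is 1/8 from \<open>N\<close> \<ge> 1/(8\<epsilon>) times 1/2 from the
  share of free columns.\<close>
proof (intro exI[of _ "1 / 16"] conjI allI impI)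
  fix d m :: nat and \<epsilon> :: real and enc :: "database \<Rightarrow> sketch pmf"
    and dec :: "sketch \<Rightarrow> nat set \<Rightarrow> answer"
  assume d: "d \<ge> 1" and \<epsilon>1: "1 / real d \<le> \<epsilon>" and \<epsilon>2: "\<epsilon> \<le> 1 / 8"
    and scheme: "itemset_frequency_indicator_scheme d 2 \<epsilon> m enc dec"
  have \<epsilon>: "\<epsilon> > 0" using d \<epsilon>1 by (smt (verit) divide_pos_pos of_nat_1 of_nat_mono)
  have \<epsilon>d: "\<epsilon> * real d \<ge> 1" using d \<epsilon>1 by (simp add: field_simps)
  \<comment> \<open>The largest \<open>N\<close> with 4\<open>N\<close>\<epsilon> \<le> 1. As
    1/(4\<epsilon>) \<ge> 2, rounding down at most halves it.\<close>
  define N where "N = nat \<lfloor>1 / (4 * \<epsilon>)\<rfloor>"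
  \<comment> \<open>The largest \<open>M\<close> that leaves at least half of the columns
    free.\<close>
  define M where "M = nat \<lfloor>real d / (2 * real N)\<rfloor>"
  have "1 / (4 * \<epsilon>) / 2 \<le> real N"
    unfolding N_def using \<epsilon> \<epsilon>2 by (intro half_le_floor) (simp add: field_simps)
  then have lo: "1 / (8 * \<epsilon>) \<le> real N" by simp
  have "real N \<le> 1 / (4 * \<epsilon>)" unfolding N_def using \<epsilon> by simp
  then have hi: "4 * real N * \<epsilon> \<le> 1" using \<epsilon> by (simp add: field_simps)
  have lo': "1 \<le> 8 * real N * \<epsilon>" using lo \<epsilon> by (simp add: field_simps)
  then have N: "N > 0" by (cases N) auto
  \<comment> \<open>The factor 2 absorbs the loss from rounding in \<open>M\<close>, so that
    \<open>M\<close> \<ge> \<epsilon>\<open>d\<close> survives.\<close>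
  have ratio: "2 * (\<epsilon> * real d) \<le> real d / (2 * real N)"
    using mult_right_mono[OF hi, of "real d"] N by (simp add: field_simps)
  then have "real d / (2 * real N) / 2 \<le> real M"
    unfolding M_def using \<epsilon>d by (intro half_le_floor) linarith
  with ratio have M: "\<epsilon> * real d \<le> real M" by simp
  then have M0: "M > 0" using \<epsilon>d by (cases M) auto
  have "real M \<le> real d / (2 * real N)" unfolding M_def by simp
  then have NM: "2 * (real N * real M) \<le> real d" using N by (simp add: field_simps)
  then have NM': "N * M \<le> d"
  proof -
    have "real (N * M) \<le> real d"
      using NM zero_le_mult_iff[of "real N" "real M"] by (simp add: order_trans)
    then show ?thesis by (simp only: of_nat_le_iff)
  qed
  have "M ^ (N * (d - N * M)) \<le> 2 ^ m"
    by (rule codeword_scheme_bound[OF scheme N M0 NM' hi lo'])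
  then have "real M ^ (N * (d - N * M)) \<le> 2 ^ m"
    by (metis of_nat_le_iff of_nat_numeral of_nat_power)
  then have "log 2 (real M ^ (N * (d - N * M))) \<le> log 2 (2 ^ m)"
    using M0 by (intro log_mono) auto
  then have main: "real N * (real d - real N * real M) * log 2 (real M) \<le> real m"
    using M0 NM' by (simp add: log_nat_power)
  have "1 / 16 * (1 / \<epsilon>) * real d * log 2 (\<epsilon> * real d)
      = 1 / (8 * \<epsilon>) * (real d / 2) * log 2 (\<epsilon> * real d)"
    by simp
  \<comment> \<open>Factorwise comparison; the logarithm on the left is nonnegative because
    \<epsilon>\<open>d\<close> \<ge> 1.\<close>
  also have "\<dots> \<le> real N * (real d - real N * real M) * log 2 (real M)"
    using lo NM M \<epsilon>d \<epsilon> M0 by (intro mult_mono log_mono) auto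
  finally show "1 / 16 * (1 / \<epsilon>) * real d * log 2 (\<epsilon> * real d) \<le> real m"
    using main by linarith
qed simp

end
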